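(* For all positive integers $N$ and $M$ and every integer $n\ge 0$, $$\sum_{\substack{0\le i\le M-1\\ 0\le j\le N-1\\ (i,j)\ne(0,0)}}\left[\sum_{k=0}^n(-1)^k\binom{n}{j;i;k-i}B_{N,n-k-j}\,B_{M,k-i}\right]$$ $$=(-1)^{M-1}\left[\binom{M+N}{M}\delta_{n-M-N}+\sum_{j=0}^{N-1}\binom{n}{M;j}B_{N,n-M-j}+(-1)^{n-M-N}\sum_{i=0}^{M-1}\binom{n}{N;i}B_{M,n-N-i}\right].$$
   Context: For a positive integer $N$, the hypergeometric Bernoulli polynomials $B_{N,n}(x)$ of order $N$ are defined by $$\frac{(t^N/N!)\,e^{xt}}{e^t-T_{N-1}(t)}=\sum_{n=0}^\infty B_{N,n}(x)\frac{t^n}{n!},\qquad T_{N-1}(t)=\sum_{m=0}^{N-1}\frac{t^m}{m!}.$$ The hypergeometric Bernoulli numbers are $B_{N,n}=B_{N,n}(0)$, and $B_{N,n}(x)=0$ (so $B_{N,n}=0$) for $n<0$. $\delta_m$ equals $1$ if $m=0$ and $0$ otherwise. Multinomial coefficients are $$\binom{n}{n_1;n_2;\dots;n_k}=\frac{n!}{n_1!\,n_2!\cdots n_k!\,(n-n_1-n_2-\cdots-n_k)!};$$ any term containing a hypergeometric Bernoulli number with negative index is $0$. *)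

theory Defs
  imports Complex_Main "HOL-Computational_Algebra.Formal_Power_Series"
begin

definition exp_taylor :: "nat \<Rightarrow> real fps" where
  "exp_taylor K = (\<Sum>m=0..K. fps_const (1 / fact m) * fps_X ^ m)"

(* For N > 0 the numerator and the denominator both have subdegree N, so the
   division of formal power series used here is exact. *)
definition hyper_bernoulli_egf :: "nat \<Rightarrow> real \<Rightarrow> real fps" where
  "hyper_bernoulli_egf N x =
     (fps_const (1 / fact N) * fps_X ^ N * fps_exp x) / (fps_exp 1 - exp_taylor (N - 1))"

definition hyper_bernpoly :: "nat \<Rightarrow> int \<Rightarrow> real \<Rightarrow> real" where
  "hyper_bernpoly N n x =
     (if n < 0 then 0 else fact (nat n) * fps_nth (hyper_bernoulli_egf N x) (nat n))"

definition hyper_bernoulli :: "nat \<Rightarrow> int \<Rightarrow> real" where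
  "hyper_bernoulli N n = hyper_bernpoly N n 0"

(* n! / (n_1! ... n_k! (n - n_1 - ... - n_k)!), which is 0 as soon as one of the
   factorials in the denominator has a negative argument. *)
definition multinom :: "int \<Rightarrow> int list \<Rightarrow> real" where
  "multinom n ks =
     (if (\<forall>k\<in>set ks. 0 \<le> k) \<and> sum_list ks \<le> n
      then fact (nat n) / ((\<Prod>k\<leftarrow>ks. fact (nat k)) * fact (nat (n - sum_list ks)))
      else 0)"

definition delta0 :: "int \<Rightarrow> real" where
  "delta0 m = (if m = 0 then 1 else 0)"

end

theory Submission
  imports Defs
begin

text \<open>
  Write \<open>F\<close> for the exponential generating function of the numbers \<open>B\<^sub>N\<close>, so that
  \<open>(e\<^sup>t - T\<^sub>N\<^sub>-\<^sub>1(t)) F(t) = t\<^sup>N / N!\<close>, and \<open>G(t)\<close> for that of the \<open>B\<^sub>M\<close> evaluated at \<open>-t\<close>, so that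
  \<open>(e\<^bsup>-t\<^esup> - T\<^sub>M\<^sub>-\<^sub>1(-t)) G(t) = (-t)\<^sup>M / M!\<close>.  Splitting the sign \<open>(-1)\<^sup>k\<close> as
  \<open>(-1)\<^sup>i (-1)\<^bsup>k-i\<^esup>\<close> shows that the inner sum over \<open>k\<close> is \<open>n!\<close> times the coefficient of \<open>t\<^sup>n\<close> in
  \<open>(t\<^sup>j / j!) F(t) \<cdot> ((-t)\<^sup>i / i!) G(t)\<close>.  Summed over all pairs \<open>(i, j)\<close> except \<open>(0, 0)\<close>, these
  products add up to \<open>(T\<^sub>N\<^sub>-\<^sub>1(t) T\<^sub>M\<^sub>-\<^sub>1(-t) - 1) F(t) G(t)\<close>.

  Since \<open>e\<^sup>t e\<^bsup>-t\<^esup> = 1\<close>, the two functional equations turn this product into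
  an expression in which \<open>F\<close> and \<open>G\<close> are no longer multiplied together (lemma
  \<open>truncation_product_identity\<close>):
  \<open>- ((t\<^sup>N / N!) ((-t)\<^sup>M / M!) + ((-t)\<^sup>M / M!) T\<^sub>N\<^sub>-\<^sub>1(t) F(t) + (t\<^sup>N / N!) T\<^sub>M\<^sub>-\<^sub>1(-t) G(t))\<close>.
  The three terms on the right-hand side of the theorem are \<open>n!\<close> times the coefficients of
  \<open>t\<^sup>n\<close> in its three summands, with the sign \<open>(-1)\<^bsup>M-1\<^esup>\<close> taken out.
\<close>

unbundle fps_syntax

lemma fps_exp_diff_exp_taylor_nth:
  "(fps_exp 1 - exp_taylor K) $ n = (if n \<le> K then 0 else 1 / fact n)"
  by (simp add: exp_taylor_def fps_sum_nth fps_X_power_nth if_distrib cong: if_cong)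

text \<open>The division defining the generating function is exact because the denominator starts
  with the term \<open>t\<^sup>N / N!\<close>, which is what makes this functional equation available.\<close>

lemma hyper_bernoulli_egf_functional_equation:
  assumes "N \<ge> 1"
  shows "(fps_exp 1 - exp_taylor (N - 1)) * hyper_bernoulli_egf N 0
           = fps_const (1 / fact N) * fps_X ^ N"
proof -
  let ?D = "fps_exp 1 - exp_taylor (N - 1) :: real fps"
  let ?X = "fps_const (1 / fact N) * fps_X ^ N :: real fps"
  have nz: "?D $ N \<noteq> 0"
    using assms by (simp only: fps_exp_diff_exp_taylor_nth) simp
  have "?D \<noteq> 0" using nz by (metis fps_zero_nth)
  moreover have "subdegree ?D = N"
    using nz by (rule subdegreeI) (use assms in \<open>simp only: fps_exp_diff_exp_taylor_nth, simp\<close>)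
  moreover have "?X \<noteq> 0" by simp
  moreover have "subdegree ?X = N"
    by (rule subdegreeI) (auto simp: fps_X_power_nth)
  ultimately have "?D dvd ?X" by (simp add: fps_dvd_iff)
  then show ?thesis by (simp add: hyper_bernoulli_egf_def)
qed

lemma hyper_bernoulli_eq_coefficient:
  "hyper_bernoulli N (int m) = fact m * hyper_bernoulli_egf N 0 $ m"
  by (simp add: hyper_bernoulli_def hyper_bernpoly_def)

text \<open>The exponential series enter only through three relations, so the cancellation at the
  heart of the proof is a statement about commutative rings.  Because \<open>e * e' = 1\<close>, the product
  \<open>F * G\<close> is \<open>(e * F) * (e' * G) = (T * F + a) * (T' * G + b)\<close>.  When
  this is expanded, the only term that still contains both \<open>F\<close> and \<open>G\<close> is \<open>T * T' * (F * G)\<close>,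
  which the left-hand side absorbs.\<close>

lemma truncation_product_identity:
  fixes e e' T T' F G a b :: "'a :: comm_ring_1"
  assumes "(e - T) * F = a" and "(e' - T') * G = b" and "e * e' = 1"
  shows "(T * T' - 1) * (F * G) = - (a * b + b * (T * F) + a * (T' * G))"
proof -
  have eF: "e * F = T * F + a" and eG: "e' * G = T' * G + b"
    using assms by (simp_all add: algebra_simps)
  have "F * G = (e * e') * (F * G)" using assms(3) by simp
  also have "\<dots> = (e * F) * (e' * G)" by (simp add: mult_ac)
  also have "\<dots> = (T * F + a) * (T' * G + b)" by (simp only: eF eG)
  finally have FG: "F * G = (T * F + a) * (T' * G + b)" .
  have "(T * T' - 1) * (F * G) = (T * F) * (T' * G) - F * G"
    by (simp add: algebra_simps)
  also have "\<dots> = (T * F) * (T' * G) - (T * F + a) * (T' * G + b)"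
    by (simp only: FG)
  finally show ?thesis by (simp add: algebra_simps)
qed

text \<open>Substituting \<open>-t\<close> for \<open>t\<close>, written as a composition so that it is visibly a ring
  homomorphism.\<close>

definition fps_reflect :: "real fps \<Rightarrow> real fps" where
  "fps_reflect f = f oo (fps_const (-1) * fps_X)"

lemma fps_reflect_nth: "fps_reflect f $ n = (-1) ^ n * f $ n"
  unfolding fps_reflect_def fps_compose_linear by simp

lemma fps_reflect_mult: "fps_reflect (f * g) = fps_reflect f * fps_reflect g"
  unfolding fps_reflect_def by (rule fps_compose_mult_distrib) simp

lemma fps_reflect_diff: "fps_reflect (f - g) = fps_reflect f - fps_reflect g"
  by (rule fps_ext) (simp add: fps_reflect_nth algebra_simps)

lemma fps_reflect_monom:
  "fps_reflect (fps_const c * fps_X ^ m) = fps_const ((-1) ^ m) * (fps_const c * fps_X ^ m)"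
  by (rule fps_ext) (simp add: fps_reflect_nth fps_X_power_nth)

lemma fps_reflect_exp: "fps_reflect (fps_exp 1) = fps_exp (-1)"
  by (rule fps_ext) (simp add: fps_reflect_nth)

lemma fps_reflect_sum: "fps_reflect (\<Sum>x\<in>A. f x) = (\<Sum>x\<in>A. fps_reflect (f x))"
  by (rule fps_ext) (simp add: fps_reflect_nth fps_sum_nth sum_distrib_left)

lemma monom_mult_nth:
  "(fps_const c * fps_X ^ m * f) $ n = (if n < m then 0 else c * f $ (n - m) :: real)"
  by (simp add: mult.assoc fps_X_power_mult_nth)

lemma multinom_of_nat:
  "multinom (int n) (map int ks) =
     (if sum_list ks \<le> n then fact n / ((\<Prod>k\<leftarrow>ks. fact k) * fact (n - sum_list ks)) else 0)"
proof -
  have "sum_list (map int ks) = int (sum_list ks)" by (induction ks) auto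
  then show ?thesis by (auto simp: multinom_def comp_def nat_diff_distrib)
qed

text \<open>A Cauchy product in which \<open>t\<^sup>k\<close> is contributed by the factor \<open>t\<^sup>i\<close> and the
  \<open>M\<close>-series, and \<open>t\<^bsup>n-k\<^esup>\<close> by \<open>t\<^sup>j\<close> and the \<open>N\<close>-series: these four exponents are the parts
  \<open>i\<close>, \<open>k - i\<close>, \<open>j\<close>, \<open>n - k - j\<close> of the multinomial coefficient.  The sign \<open>(-1)\<^sup>k\<close>
  is the one that reflection puts on the coefficient of \<open>t\<^sup>k\<close>.  Terms with a negative index vanish on both sides: on the left through the multinomial coefficient, on the
  right through the coefficients of the shifted series.\<close>

lemma multinom_convolution:
  "(\<Sum>k = 0..n. (-1) ^ k * multinom (int n) [int j, int i, int k - int i]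
      * hyper_bernoulli N (int n - int k - int j) * hyper_bernoulli M (int k - int i))
   = fact n * (fps_reflect (fps_const (1 / fact i) * fps_X ^ i * hyper_bernoulli_egf M 0)
               * (fps_const (1 / fact j) * fps_X ^ j * hyper_bernoulli_egf N 0)) $ n"
  unfolding fps_mult_nth[of "fps_reflect _"] sum_distrib_left
proof (rule sum.cong[OF refl], goal_cases)
  case (1 k)
  then have kn: "k \<le> n" by simp
  show ?case
  proof (cases "i \<le> k \<and> j \<le> n - k")
    case True
    then have idx: "int k - int i = int (k - i)" "int n - int k - int j = int (n - k - j)"
      using kn by auto
    have le: "j + k \<le> n" using True kn by linarith
    have "multinom (int n) [int j, int i, int (k - i)]
        = fact n / (fact j * (fact i * fact (k - i)) * fact (n - k - j))"
      using True le multinom_of_nat[of n "[j, i, k - i]"]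
      by (simp add: add.commute del: of_nat_diff)
    moreover have "(-1 :: real) ^ k = (-1) ^ i * (-1) ^ (k - i)"
      using True by (simp flip: power_add)
    ultimately show ?thesis
      using True
      unfolding idx hyper_bernoulli_eq_coefficient fps_reflect_nth monom_mult_nth
      by (simp add: field_simps)
  next
    case False
    then have "multinom (int n) [int j, int i, int k - int i] = 0"
      using kn by (auto simp: multinom_def)
    then show ?thesis
      using False by (auto simp: fps_reflect_nth monom_mult_nth)
  qed
qed

lemma multinom_shift:
  "multinom (int n) [int a, int j] * hyper_bernoulli N (int n - int a - int j)
   = fact n * (fps_const (1 / fact a) * fps_X ^ a
       * (fps_const (1 / fact j) * fps_X ^ j * hyper_bernoulli_egf N 0)) $ n"
proof (cases "a + j \<le> n")
  case True
  then have idx: "int n - int a - int j = int (n - a - j)" by auto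
  show ?thesis
    using True multinom_of_nat[of n "[a, j]"]
    unfolding idx hyper_bernoulli_eq_coefficient monom_mult_nth
    by (simp add: field_simps)
next
  case False
  then show ?thesis unfolding monom_mult_nth by (auto simp: multinom_def)
qed

lemma multinom_sum_eq_coefficient:
  "(\<Sum>j = 0..K. multinom (int n) [int a, int j] * hyper_bernoulli N (int n - int a - int j))
   = fact n * (fps_const (1 / fact a) * fps_X ^ a
       * (exp_taylor K * hyper_bernoulli_egf N 0)) $ n"
  by (simp only: multinom_shift exp_taylor_def sum_distrib_right sum_distrib_left fps_sum_nth)

lemma binomial_delta0:
  "real ((M + N) choose M) * delta0 (int n - int M - int N)
   = fact n * (fps_const (1 / fact M) * fps_X ^ M * (fps_const (1 / fact N) * fps_X ^ N)) $ n"
proof -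
  have "int n - int M - int N = 0 \<longleftrightarrow> n = M + N" by auto
  then show ?thesis
    unfolding monom_mult_nth delta0_def
    by (auto simp: fps_X_power_nth binomial_fact)
qed

theorem theorem5:
  fixes N M n :: nat
  assumes "N \<ge> 1" and "M \<ge> 1"
  shows
    "(\<Sum>(i, j) \<in> {0..M - 1} \<times> {0..N - 1} - {(0, 0)}.
        \<Sum>k = 0..n. (-1) ^ k * multinom (int n) [int j, int i, int k - int i]
          * hyper_bernoulli N (int n - int k - int j) * hyper_bernoulli M (int k - int i))
     = (-1) ^ (M - 1) *
        (real ((M + N) choose M) * delta0 (int n - int M - int N)
         + (\<Sum>j = 0..N - 1. multinom (int n) [int M, int j]
              * hyper_bernoulli N (int n - int M - int j))
         + (-1) powi (int n - int M - int N)
           * (\<Sum>i = 0..M - 1. multinom (int n) [int N, int i]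
                * hyper_bernoulli M (int n - int N - int i)))"
    (is "?lhs = _ * (?delta + ?SN + _ * ?SM)")
proof -
  define F where "F = hyper_bernoulli_egf N 0"
  define H where "H = hyper_bernoulli_egf M 0"
  define T where "T = exp_taylor (N - 1)"
  define S where "S = exp_taylor (M - 1)"
  define a where "a = (fps_const (1 / fact N) * fps_X ^ N :: real fps)"
  define b where "b = (fps_const (1 / fact M) * fps_X ^ M :: real fps)"
  let ?f = "\<lambda>j. fps_const (1 / fact j) * fps_X ^ j * F"
  let ?g = "\<lambda>i. fps_reflect (fps_const (1 / fact i) * fps_X ^ i * H)"
  have feq_F: "(fps_exp 1 - T) * F = a"
    unfolding F_def T_def a_def
    using assms(1) by (rule hyper_bernoulli_egf_functional_equation)
  have "(fps_exp 1 - S) * H = b"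
    unfolding H_def S_def b_def
    using assms(2) by (rule hyper_bernoulli_egf_functional_equation)
  then have "(fps_reflect (fps_exp 1) - fps_reflect S) * fps_reflect H = fps_reflect b"
    by (simp only: fps_reflect_mult[symmetric] fps_reflect_diff[symmetric])
  then have feq_G: "(fps_exp (-1) - fps_reflect S) * fps_reflect H = fps_const ((-1) ^ M) * b"
    by (simp only: fps_reflect_exp b_def fps_reflect_monom)
  have exp_inverse: "fps_exp 1 * fps_exp (-1) = (1 :: real fps)"
    by (simp flip: fps_exp_add_mult)

  have f_sum: "(\<Sum>j = 0..N - 1. ?f j) = T * F"
    by (simp add: T_def exp_taylor_def sum_distrib_right)
  have g_sum: "(\<Sum>i = 0..M - 1. ?g i) = fps_reflect S * fps_reflect H"
    by (simp add: S_def exp_taylor_def sum_distrib_right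
        flip: fps_reflect_sum fps_reflect_mult)
  have "(\<Sum>(i, j) \<in> {0..M - 1} \<times> {0..N - 1} - {(0, 0)}. ?g i * ?f j)
      = (\<Sum>(i, j) \<in> {0..M - 1} \<times> {0..N - 1}. ?g i * ?f j) - ?g 0 * ?f 0"
    by (subst sum_diff1) auto
  also have "\<dots> = (\<Sum>i = 0..M - 1. ?g i) * (\<Sum>j = 0..N - 1. ?f j) - ?g 0 * ?f 0"
    by (simp only: sum_product sum.cartesian_product)
  also have "\<dots> = (T * fps_reflect S - 1) * (F * fps_reflect H)"
    by (simp only: f_sum g_sum) (simp add: algebra_simps)
  also have "\<dots> = - (a * (fps_const ((-1) ^ M) * b) + fps_const ((-1) ^ M) * b * (T * F)
      + a * (fps_reflect S * fps_reflect H))"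
    using feq_F feq_G exp_inverse by (rule truncation_product_identity)
  also have "\<dots> = - (fps_const ((-1) ^ M) * (b * a + b * (T * F))
      + a * fps_reflect (S * H))"
    by (simp add: algebra_simps fps_reflect_mult)
  finally have egf: "(\<Sum>(i, j) \<in> {0..M - 1} \<times> {0..N - 1} - {(0, 0)}. ?g i * ?f j) = \<dots>" .

  \<comment> \<open>Moving the factor \<open>t\<^sup>N\<close> out of the reflected series costs \<open>(-1)\<^sup>N\<close>.\<close>
  have "a * fps_reflect (S * H) = fps_const ((-1) ^ N) * fps_reflect (a * (S * H))"
  proof (rule fps_ext)
    fix m
    show "(a * fps_reflect (S * H)) $ m
        = (fps_const ((-1) ^ N) * fps_reflect (a * (S * H))) $ m"
      unfolding a_def fps_mult_left_const_nth fps_reflect_nth monom_mult_nth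
      by (auto simp: minus_one_power_iff)
  qed
  then have SM: "fact n * (a * fps_reflect (S * H)) $ n = (-1) ^ N * (-1) ^ n * ?SM"
    unfolding multinom_sum_eq_coefficient
    by (simp add: fps_reflect_nth a_def S_def H_def)
  have SN: "fact n * (b * (T * F)) $ n = ?SN"
    unfolding multinom_sum_eq_coefficient by (simp add: b_def T_def F_def)
  have delta: "fact n * (b * a) $ n = ?delta"
    unfolding binomial_delta0 by (simp add: a_def b_def)

  have sign: "(-1) powi (int n - int M - int N) = (-1 :: real) ^ M * ((-1) ^ N * (-1) ^ n)"
    by (cases "even M"; cases "even N"; cases "even n") (auto simp: power_int_minus_left)
  have sign_M: "(-1) ^ (M - 1) = - ((-1 :: real) ^ M)"
    using assms(2) by (cases M) auto

  have "?lhs = fact n * (\<Sum>(i, j) \<in> {0..M - 1} \<times> {0..N - 1} - {(0, 0)}. ?g i * ?f j) $ n"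
    unfolding multinom_convolution F_def H_def
    by (simp add: fps_sum_nth sum_distrib_left case_prod_unfold)
  also have "\<dots> = - ((-1) ^ M * (fact n * (b * a) $ n + fact n * (b * (T * F)) $ n)
      + fact n * (a * fps_reflect (S * H)) $ n)"
    unfolding egf fps_neg_nth fps_add_nth fps_mult_left_const_nth by argo
  also have "\<dots> = - ((-1) ^ M * (?delta + ?SN) + (-1) ^ N * (-1) ^ n * ?SM)"
    by (simp only: delta SN SM)
  also have "\<dots> = (-1) ^ (M - 1) *
      (?delta + ?SN + (-1) powi (int n - int M - int N) * ?SM)"
    unfolding sign sign_M by (cases "even M") (simp_all add: algebra_simps)
  finally show ?thesis .
qed

end
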